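(* Suppose there are $N=3$ options, the two players have the same preferences ($A_i=B_i$ for $i=1,2,3$), and all the popularities $S_i=A_i+B_i$ are less than $1$. If the amplitude terms $a_k,b_k$ of the Pure Hong-Ou-Mandel method are set so that $$a_1^2:a_2^2:a_3^2 \;=\; b_1^2:b_2^2:b_3^2 \;=\; \frac{\sin^2\frac{\theta_2-\theta_3}{2}}{1-2A_1}:\frac{\sin^2\frac{\theta_3-\theta_1}{2}}{1-2A_2}:\frac{\sin^2\frac{\theta_1-\theta_2}{2}}{1-2A_3},$$ then the resulting joint selection probability matrix $\boldsymbol{P}=(p_{i,j})$ achieves the theoretical minimum loss.
   Context: Two players A and B have probabilistic preferences $(A_1,\dots,A_N)$ and $(B_1,\dots,B_N)$ over $N$ options: $A_i,B_i\ge 0$ and $\sum_i A_i=\sum_i B_i=1$. The popularity of option $i$ is $S_i=A_i+B_i$. A joint selection probability matrix is an $N\times N$ real matrix $\boldsymbol{P}=(p_{i,j})$ with $p_{i,j}\ge 0$, $\sum_{i,j}p_{i,j}=1$ and zero diagonal (no choice conflict); $p_{i,j}$ is the probability that A is assigned option $i$ and B is assigned option $j$. Its satisfied preferences are $\pi_A(i)=\sum_j p_{i,j}$ and $\pi_B(j)=\sum_i p_{i,j}$, and its loss is $$L=\sum_i(\pi_A(i)-A_i)^2+\sum_j(\pi_B(j)-B_j)^2.$$ The theoretical minimum loss is the minimum of $L$ over all joint selection probability matrices, for the given preferences. Pure Hong-Ou-Mandel method: player A prepares a photon in the state $\sum_{k=1}^{N} a_k e^{i\phi_k}|{+k}\rangle$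 with $\sum_k a_k^2=1$, and player B prepares a photon in the state $\sum_{k=1}^{N} b_k e^{i\psi_k}|{-k}\rangle$ with $\sum_k b_k^2=1$; the $a_k,b_k$ are the amplitude terms and the $\phi_k,\psi_k$ the phases. Put $\theta_k=\phi_k-\psi_k$. After interference of the two photons at a beam splitter, the probability of detecting $|{+i}\rangle$ on side A and $|{-j}\rangle$ on side B is $$r_{i,j}=\tfrac14\left(a_i^2b_j^2+a_j^2b_i^2-2a_ia_jb_ib_j\cos(\theta_i-\theta_j)\right),$$ and, other outcomes being discarded, the resulting joint selection probability matrix has entries $$p_{i,j}=\frac{r_{i,j}}{\sum_{k,l}r_{k,l}}.$$
   Formalization: The amplitude terms a_k, b_k are taken to be nonnegative (signs belong to the phases; with arbitrary signs the claim fails), and the sum of the r_{k,l} is assumed nonzero, since otherwise (e.g. when θ_2=θ_3≠θ_1) the matrix P is undefined. *)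

theory Defs
  imports "HOL-Analysis.Analysis"
begin

text \<open>The options are the elements of a finite index type, so \<open>N = CARD('n)\<close>.\<close>

definition preferences :: "real ^ 'n \<Rightarrow> bool" where
  "preferences A \<longleftrightarrow> (\<forall>i. 0 \<le> A $ i) \<and> (\<Sum>i\<in>UNIV. A $ i) = 1"

definition popularity :: "real ^ 'n \<Rightarrow> real ^ 'n \<Rightarrow> 'n \<Rightarrow> real" where
  "popularity A B i = A $ i + B $ i"

definition joint_selection_matrix :: "real ^ 'n ^ 'n \<Rightarrow> bool" where
  "joint_selection_matrix P \<longleftrightarrow>
     (\<forall>i j. 0 \<le> P $ i $ j) \<and> (\<Sum>i\<in>UNIV. \<Sum>j\<in>UNIV. P $ i $ j) = 1 \<and> (\<forall>i. P $ i $ i = 0)"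

definition satisfied_A :: "real ^ 'n ^ 'n \<Rightarrow> 'n \<Rightarrow> real" where
  "satisfied_A P i = (\<Sum>j\<in>UNIV. P $ i $ j)"

definition satisfied_B :: "real ^ 'n ^ 'n \<Rightarrow> 'n \<Rightarrow> real" where
  "satisfied_B P j = (\<Sum>i\<in>UNIV. P $ i $ j)"

definition loss :: "real ^ 'n \<Rightarrow> real ^ 'n \<Rightarrow> real ^ 'n ^ 'n \<Rightarrow> real" where
  "loss A B P =
     (\<Sum>i\<in>UNIV. (satisfied_A P i - A $ i)\<^sup>2) + (\<Sum>j\<in>UNIV. (satisfied_B P j - B $ j)\<^sup>2)"

text \<open>For at least two options the joint selection matrices form a nonempty compact set,
  on which the loss is continuous, so this infimum is a minimum.\<close>

definition theoretical_minimum_loss :: "real ^ 'n \<Rightarrow> real ^ 'n \<Rightarrow> real" where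
  "theoretical_minimum_loss A B = (INF P \<in> {P. joint_selection_matrix P}. loss A B P)"

text \<open>In a state \<open>\<Sum>k. a\<^sub>k exp (\<i> \<phi>\<^sub>k) |k\<rangle>\<close> the coefficients are in polar form: the amplitude
  terms are nonnegative, a sign being part of the phase. The detection probabilities below
  are sensitive to these signs.\<close>

definition amplitude_terms :: "real ^ 'n \<Rightarrow> bool" where
  "amplitude_terms a \<longleftrightarrow> (\<forall>k. 0 \<le> a $ k) \<and> (\<Sum>k\<in>UNIV. (a $ k)\<^sup>2) = 1"

definition hom_detection ::
    "real ^ 'n \<Rightarrow> real ^ 'n \<Rightarrow> real ^ 'n \<Rightarrow> 'n \<Rightarrow> 'n \<Rightarrow> real" where
  "hom_detection a b \<theta> i j =
     1 / 4 * ((a $ i)\<^sup>2 * (b $ j)\<^sup>2 + (a $ j)\<^sup>2 * (b $ i)\<^sup>2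
              - 2 * a $ i * a $ j * b $ i * b $ j * cos (\<theta> $ i - \<theta> $ j))"

definition hom_total :: "real ^ 'n \<Rightarrow> real ^ 'n \<Rightarrow> real ^ 'n \<Rightarrow> real" where
  "hom_total a b \<theta> = (\<Sum>k\<in>UNIV. \<Sum>l\<in>UNIV. hom_detection a b \<theta> k l)"

text \<open>Only meaningful if \<open>hom_total a b \<theta> \<noteq> 0\<close>, that is, if not every outcome is discarded.\<close>

definition hom_matrix :: "real ^ 'n \<Rightarrow> real ^ 'n \<Rightarrow> real ^ 'n \<Rightarrow> real ^ 'n ^ 'n" where
  "hom_matrix a b \<theta> = (\<chi> i j. hom_detection a b \<theta> i j / hom_total a b \<theta>)"

text \<open>\<open>u\<^sub>1 : \<dots> : u\<^sub>N = v\<^sub>1 : \<dots> : v\<^sub>N\<close>, where individual terms may vanish.\<close>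

definition same_ratio :: "real ^ 'n \<Rightarrow> real ^ 'n \<Rightarrow> bool" where
  "same_ratio u v \<longleftrightarrow> (\<exists>c. c \<noteq> 0 \<and> u = c *\<^sub>R v)"

end

theory Submission
  imports Defs
begin

text \<open>Equal ratios of normalised amplitudes force \<open>a = b\<close>, so \<open>r\<^sub>i\<^sub>j = a\<^sub>i\<^sup>2 a\<^sub>j\<^sup>2 sin\<^sup>2 ((\<theta>\<^sub>i - \<theta>\<^sub>j) / 2)\<close>.
  For the prescribed amplitudes, the product of the three squared sines appears in every
  \<open>r\<^sub>i\<^sub>j\<close> with \<open>i \<noteq> j\<close>, so \<open>r\<^sub>i\<^sub>j\<close> is proportional to \<open>1 - 2 A\<^sub>k\<close>, where \<open>k\<close> is the third
  option. Normalisation gives \<open>p\<^sub>i\<^sub>j = (1 - 2 A\<^sub>k) / 2\<close>, whose row and column sums are exactly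
  the preferences: the loss is zero.\<close>

text \<open>Summing over all options and using both normalisations gives ratio constant 1;
  nonnegativity then allows square roots.\<close>

lemma same_ratio_amplitude_terms_eq:
  assumes "amplitude_terms a" "amplitude_terms b"
    and "same_ratio (\<chi> k. (a $ k)\<^sup>2) (\<chi> k. (b $ k)\<^sup>2)"
  shows "a = b"
proof -
  obtain c where c: "(\<chi> k. (a $ k)\<^sup>2) = c *\<^sub>R (\<chi> k. (b $ k)\<^sup>2)"
    using assms(3) unfolding same_ratio_def by blast
  have ab: "(a $ k)\<^sup>2 = c * (b $ k)\<^sup>2" for k
    using arg_cong[OF c, of "\<lambda>v. v $ k"] by simp
  then have "(\<Sum>k\<in>UNIV. (a $ k)\<^sup>2) = c * (\<Sum>k\<in>UNIV. (b $ k)\<^sup>2)"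
    by (simp add: sum_distrib_left)
  then have "c = 1"
    using assms(1,2) by (simp add: amplitude_terms_def)
  then show ?thesis
    using ab assms(1,2) by (auto simp: vec_eq_iff amplitude_terms_def intro!: power2_eq_imp_eq)
qed

text \<open>Half-angle formula: the interference term combines with the two equal products into a
  multiple of \<open>1 - cos\<close>.\<close>

lemma hom_detection_same_amplitudes:
  "hom_detection a a \<theta> i j =
     (a $ i)\<^sup>2 * (a $ j)\<^sup>2 * (sin ((\<theta> $ i - \<theta> $ j) / 2))\<^sup>2"
proof -
  have "cos (\<theta> $ i - \<theta> $ j) = 1 - 2 * (sin ((\<theta> $ i - \<theta> $ j) / 2))\<^sup>2"
    using cos_double_sin[of "(\<theta> $ i - \<theta> $ j) / 2"]
    by (simp only: mult_2 field_sum_of_halves)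
  then show ?thesis
    unfolding hom_detection_def by (simp only:) (simp add: power2_eq_square algebra_simps)
qed

lemma loss_nonneg: "0 \<le> loss A B P"
  by (simp add: loss_def sum_nonneg)

text \<open>Zero is a lower bound of the loss, attained at \<open>P\<close>; \<open>P\<close> also
  witnesses that the infimum is over a nonempty set.\<close>

lemma theoretical_minimum_loss_eq_zero:
  assumes "joint_selection_matrix P" "loss A B P = 0"
  shows "theoretical_minimum_loss A B = 0"
proof (rule antisym)
  show "theoretical_minimum_loss A B \<le> 0"
    unfolding theoretical_minimum_loss_def
    using assms by (intro cINF_lower2[where x = P] bdd_belowI2[where m = 0]) (auto simp: loss_nonneg)
  show "0 \<le> theoretical_minimum_loss A B"
    unfolding theoretical_minimum_loss_def
    using assms by (intro cINF_greatest) (auto simp: loss_nonneg)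
qed

theorem mainTheorem1:
  fixes A B a b \<phi> \<psi> \<theta> :: "real ^ 3"
  assumes "preferences A" and "preferences B"
    and "\<And>i. A $ i = B $ i"
    and "\<And>i. popularity A B i < 1"
    and "amplitude_terms a" and "amplitude_terms b"
    and "\<And>k. \<theta> $ k = \<phi> $ k - \<psi> $ k"
    and "same_ratio (\<chi> k. (a $ k)\<^sup>2) (\<chi> k. (b $ k)\<^sup>2)"
    and "same_ratio (\<chi> k. (b $ k)\<^sup>2)
           (vector [(sin ((\<theta> $ 2 - \<theta> $ 3) / 2))\<^sup>2 / (1 - 2 * A $ 1),
                    (sin ((\<theta> $ 3 - \<theta> $ 1) / 2))\<^sup>2 / (1 - 2 * A $ 2),
                    (sin ((\<theta> $ 1 - \<theta> $ 2) / 2))\<^sup>2 / (1 - 2 * A $ 3)])"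
    and "hom_total a b \<theta> \<noteq> 0"
  shows "joint_selection_matrix (hom_matrix a b \<theta>) \<and>
         loss A B (hom_matrix a b \<theta>) = theoretical_minimum_loss A B"
proof -
  have a_eq_b: "a = b"
    using assms(5,6,8) by (rule same_ratio_amplitude_terms_eq)
  define s1 s2 s3 where "s1 = (sin ((\<theta> $ 2 - \<theta> $ 3) / 2))\<^sup>2"
    and "s2 = (sin ((\<theta> $ 3 - \<theta> $ 1) / 2))\<^sup>2"
    and "s3 = (sin ((\<theta> $ 1 - \<theta> $ 2) / 2))\<^sup>2"
  note s_defs = s1_def s2_def s3_def
  define w where "w i = 1 - 2 * A $ i" for i
  \<comment> \<open>Equal preferences make the popularity \<open>2 * A $ i\<close>.\<close>
  have w_pos: "0 < w i" for i
    using assms(4)[of i] assms(3)[of i] by (simp add: w_def popularity_def)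
  have sum_A: "A $ 1 + A $ 2 + A $ 3 = 1"
    using assms(1) by (simp add: preferences_def sum_3)
  obtain c where c: "(\<chi> k. (b $ k)\<^sup>2) = c *\<^sub>R (vector [s1 / w 1, s2 / w 2, s3 / w 3] :: real ^ 3)"
    using assms(9) unfolding same_ratio_def s_defs w_def by blast
  have b_sq: "(b $ 1)\<^sup>2 = c * (s1 / w 1)" "(b $ 2)\<^sup>2 = c * (s2 / w 2)"
    "(b $ 3)\<^sup>2 = c * (s3 / w 3)"
    using arg_cong[OF c, of "\<lambda>v. v $ 1"] arg_cong[OF c, of "\<lambda>v. v $ 2"]
      arg_cong[OF c, of "\<lambda>v. v $ 3"] by simp_all
  \<comment> \<open>For distinct i, j and third option k, the detection probability is
    \<open>(c * s_i / w_i) * (c * s_j / w_j) * s_k\<close>, which is \<open>K * w_k\<close>.\<close>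
  define K where "K = c\<^sup>2 * s1 * s2 * s3 / (w 1 * w 2 * w 3)"
  have sin_sq_commute: "(sin ((x - y) / 2))\<^sup>2 = (sin ((y - x) / 2))\<^sup>2" for x y :: real
    by (metis minus_diff_eq minus_divide_left power2_minus sin_minus)
  have commute: "hom_detection a b \<theta> i j = hom_detection a b \<theta> j i" for i j
    unfolding a_eq_b hom_detection_same_amplitudes
    using sin_sq_commute[of "\<theta> $ i" "\<theta> $ j"] by simp
  have diag: "hom_detection a b \<theta> i i = 0" for i
    by (simp add: a_eq_b hom_detection_same_amplitudes)
  have w_nz: "w i \<noteq> 0" for i
    using w_pos[of i] by simp
  have r12: "hom_detection a b \<theta> 1 2 = K * w 3"
    and r23: "hom_detection a b \<theta> 2 3 = K * w 1"
    and r31: "hom_detection a b \<theta> 3 1 = K * w 2"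
    unfolding a_eq_b hom_detection_same_amplitudes b_sq K_def s_defs[symmetric]
    by (simp_all add: w_nz field_simps power2_eq_square)
  have r: "hom_detection a b \<theta> 2 1 = K * w 3" "hom_detection a b \<theta> 3 2 = K * w 1"
    "hom_detection a b \<theta> 1 3 = K * w 2"
    using r12 r23 r31 commute by metis+
  have total: "hom_total a b \<theta> = 2 * K"
  proof -
    have "hom_total a b \<theta> = 2 * K * (w 1 + w 2 + w 3)"
      by (simp add: hom_total_def sum_3 diag r12 r23 r31 r algebra_simps)
    also have "w 1 + w 2 + w 3 = 1"
      using sum_A by (simp add: w_def)
    finally show ?thesis by simp
  qed
  \<comment> \<open>Some outcome is kept, so \<open>K\<close> cancels in the quotients
    \<open>K * w_k / (2 * K)\<close>.\<close>
  then have "K \<noteq> 0"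
    using assms(10) by simp
  then have p: "hom_matrix a b \<theta> $ 1 $ 2 = w 3 / 2" "hom_matrix a b \<theta> $ 2 $ 1 = w 3 / 2"
    "hom_matrix a b \<theta> $ 2 $ 3 = w 1 / 2" "hom_matrix a b \<theta> $ 3 $ 2 = w 1 / 2"
    "hom_matrix a b \<theta> $ 3 $ 1 = w 2 / 2" "hom_matrix a b \<theta> $ 1 $ 3 = w 2 / 2"
    by (simp_all add: hom_matrix_def total r12 r23 r31 r)
  have p_diag: "hom_matrix a b \<theta> $ i $ i = 0" for i
    by (simp add: hom_matrix_def diag)
  have joint: "joint_selection_matrix (hom_matrix a b \<theta>)"
    using sum_A less_imp_le[OF w_pos]
    by (auto simp: joint_selection_matrix_def forall_3 sum_3 p p_diag) (simp add: w_def)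
  \<comment> \<open>With j, k the other two options, both sums are
    \<open>(w_j + w_k) / 2 = 1 - A_j - A_k = A_i\<close>.\<close>
  have "satisfied_A (hom_matrix a b \<theta>) i = A $ i" "satisfied_B (hom_matrix a b \<theta>) i = A $ i" for i
    using exhaust_3[of i] sum_A
    by (auto simp: satisfied_A_def satisfied_B_def sum_3 p p_diag w_def field_simps)
  then have "loss A B (hom_matrix a b \<theta>) = 0"
    using assms(3) by (simp add: loss_def)
  then show ?thesis
    using joint theoretical_minimum_loss_eq_zero by metis
qed

end
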